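(* (In $\mathsf{ZF}$.) For the additive group $(\mathbb{R},+)$, $\mathbb{R}\not\to(2)^{\operatorname{FS}}_{\omega}$. That is, there exists a colouring $c:\mathbb{R}\to\omega$ such that there are no two distinct $x,y\in\mathbb{R}$ with $\{x,y,x+y\}$ monochromatic.
   Context: The base theory is $\mathsf{ZF}$ (no form of the Axiom of Choice is assumed). For a commutative semigroup $G$ and cardinals $\kappa,\theta$, $G\to(\kappa)^{\operatorname{FS}}_{\theta}$ means that for every colouring $c:G\to\theta$ there is an injective sequence $\vec{x}$ in $G$ indexed by $\kappa$ such that $c$ is constant on $\operatorname{FS}(\vec{x})$, the set of all sums of finitely many (at least one) terms of $\vec{x}$ with distinct indices; $\not\to$ denotes its negation. *)

theory Defs
  imports Complex_Main
begin

section \<open>The partition relation in HOL\<close>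

definition FS :: "('i \<Rightarrow> 'a::comm_monoid_add) \<Rightarrow> 'i set \<Rightarrow> 'a set" where
  "FS x I = {sum x A | A. finite A \<and> A \<noteq> {} \<and> A \<subseteq> I}"

text \<open>The cardinals \<open>\<kappa>\<close> and \<open>\<theta>\<close> are given by sets \<open>I\<close> and \<open>K\<close> of that size.\<close>

definition fs_arrow :: "'a::comm_monoid_add set \<Rightarrow> 'i set \<Rightarrow> 'c set \<Rightarrow> bool" where
  "fs_arrow G I K \<longleftrightarrow>
     (\<forall>c. c ` G \<subseteq> K \<longrightarrow>
        (\<exists>x. x ` I \<subseteq> G \<and> inj_on x I \<and> (\<exists>k. \<forall>s \<in> FS x I. c s = k)))"


section \<open>Models of ZF\<close>

text \<open>
  HOL has a choice operator, so a theorem about the type of reals does not by itself say that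
  choice can be avoided.  Derivability in ZF is therefore rendered as truth in every first-order
  structure \<open>('v, mem)\<close> that satisfies the axioms of ZF; by the completeness theorem the two
  coincide.  It is essential that separation and replacement range over first-order formulas with
  parameters only: with arbitrary HOL predicates, the choice operator of HOL would make the axiom
  of choice true in every such structure.
\<close>

datatype fm = In nat nat | Eq nat nat | Neg fm | Conj fm fm | All nat fm

locale membership =
  fixes mem :: "'v \<Rightarrow> 'v \<Rightarrow> bool"
begin

primrec sat :: "(nat \<Rightarrow> 'v) \<Rightarrow> fm \<Rightarrow> bool" where
  "sat s (In i j) \<longleftrightarrow> mem (s i) (s j)"
| "sat s (Eq i j) \<longleftrightarrow> s i = s j"
| "sat s (Neg p) \<longleftrightarrow> \<not> sat s p"
| "sat s (Conj p q) \<longleftrightarrow> sat s p \<and> sat s q"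
| "sat s (All i p) \<longleftrightarrow> (\<forall>a. sat (s(i := a)) p)"

definition elts :: "'v \<Rightarrow> 'v set" where
  "elts x = {y. mem y x}"

definition is_inductive :: "'v \<Rightarrow> bool" where
  "is_inductive w \<longleftrightarrow>
     (\<exists>z \<in> elts w. elts z = {}) \<and>
     (\<forall>y \<in> elts w. \<exists>z \<in> elts w. elts z = insert y (elts y))"

end

text \<open>
  In separation variable 0, and in replacement variables 0 and 1, are the designated ones; all other
  variables of the formula \<open>p\<close> are parameters, with values given by the assignment \<open>s\<close>.
\<close>

locale zf_model = membership mem for mem :: "'v \<Rightarrow> 'v \<Rightarrow> bool" +
  assumes extensionality: "elts x = elts y \<Longrightarrow> x = y"
    and foundation: "elts x \<noteq> {} \<Longrightarrow> \<exists>y \<in> elts x. elts y \<inter> elts x = {}"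
    and pairing: "\<exists>z. elts z = {x, y}"
    and union: "\<exists>z. elts z = (\<Union>y \<in> elts x. elts y)"
    and power_set: "\<exists>z. elts z = {y. elts y \<subseteq> elts x}"
    and infinity: "\<exists>w. is_inductive w"
    and separation: "\<exists>z. elts z = {a \<in> elts x. sat (s(0 := a)) p}"
    and replacement:
      "(\<And>a. a \<in> elts x \<Longrightarrow> \<exists>!b. sat (s(0 := a, 1 := b)) p) \<Longrightarrow>
         \<exists>z. elts z = {b. \<exists>a \<in> elts x. sat (s(0 := a, 1 := b)) p}"


section \<open>The notions of the statement inside a structure\<close>

text \<open>
  Sets, functions, sequences and colourings below are elements of \<open>'v\<close>, and all
  quantifiers range over \<open>'v\<close>, so every notion is first-order in \<open>mem\<close>.  The definite
  descriptions denote as soon as the structure is a model of ZF (for \<open>val\<close>: when the argument is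
  in the domain of the function).
\<close>

context membership
begin

definition empty_set :: 'v where
  "empty_set = (THE z. elts z = {})"

definition suc :: "'v \<Rightarrow> 'v" where
  "suc x = (THE z. elts z = insert x (elts x))"

definition omega :: 'v where
  "omega = (THE w. elts w = {n. \<forall>v. is_inductive v \<longrightarrow> n \<in> elts v})"

definition two :: 'v where
  "two = suc (suc empty_set)"

definition upair :: "'v \<Rightarrow> 'v \<Rightarrow> 'v" where
  "upair x y = (THE z. elts z = {x, y})"

definition opair :: "'v \<Rightarrow> 'v \<Rightarrow> 'v" where
  "opair x y = upair (upair x x) (upair x y)"

definition rel :: "'v \<Rightarrow> 'v \<Rightarrow> 'v \<Rightarrow> bool" where
  "rel r x y \<longleftrightarrow> opair x y \<in> elts r"

definition maps :: "'v \<Rightarrow> 'v \<Rightarrow> 'v \<Rightarrow> bool" where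
  "maps f A B \<longleftrightarrow>
     elts f \<subseteq> {opair x y | x y. x \<in> elts A \<and> y \<in> elts B} \<and>
     (\<forall>x \<in> elts A. \<exists>!y. rel f x y)"

definition val :: "'v \<Rightarrow> 'v \<Rightarrow> 'v" where
  "val f x = (THE y. rel f x y)"

definition injects :: "'v \<Rightarrow> 'v \<Rightarrow> 'v \<Rightarrow> bool" where
  "injects f A B \<longleftrightarrow> maps f A B \<and> inj_on (val f) (elts A)"

text \<open>\<open>f\<close> is a function from \<open>A \<times> A\<close> to \<open>A\<close>.\<close>

definition binop :: "'v \<Rightarrow> 'v \<Rightarrow> bool" where
  "binop f A \<longleftrightarrow>
     elts f \<subseteq> {opair (opair x y) z | x y z. x \<in> elts A \<and> y \<in> elts A \<and> z \<in> elts A} \<and>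
     (\<forall>x \<in> elts A. \<forall>y \<in> elts A. \<exists>!z. rel f (opair x y) z)"

definition val2 :: "'v \<Rightarrow> 'v \<Rightarrow> 'v \<Rightarrow> 'v" where
  "val2 f x y = val f (opair x y)"

text \<open>
  The reals are characterised, up to isomorphism and provably in ZF, as the complete ordered
  field; the subsets \<open>S\<close> in the completeness clause are those of the structure.
\<close>

definition complete_ordered_field :: "'v \<Rightarrow> 'v \<Rightarrow> 'v \<Rightarrow> 'v \<Rightarrow> bool" where
  "complete_ordered_field R add mult lt \<longleftrightarrow>
     binop add R \<and> binop mult R \<and>
     (\<forall>x \<in> elts R. \<forall>y \<in> elts R. val2 add x y = val2 add y x \<and> val2 mult x y = val2 mult y x) \<and>
     (\<forall>x \<in> elts R. \<forall>y \<in> elts R. \<forall>z \<in> elts R.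
        val2 add (val2 add x y) z = val2 add x (val2 add y z) \<and>
        val2 mult (val2 mult x y) z = val2 mult x (val2 mult y z) \<and>
        val2 mult x (val2 add y z) = val2 add (val2 mult x y) (val2 mult x z)) \<and>
     (\<exists>u \<in> elts R. \<exists>e \<in> elts R. u \<noteq> e \<and>
        (\<forall>x \<in> elts R. val2 add x u = x \<and> val2 mult x e = x \<and>
           (\<exists>y \<in> elts R. val2 add x y = u) \<and>
           (x \<noteq> u \<longrightarrow> (\<exists>y \<in> elts R. val2 mult x y = e))) \<and>
        (\<forall>x \<in> elts R. \<forall>y \<in> elts R.
           rel lt u x \<and> rel lt u y \<longrightarrow> rel lt u (val2 mult x y))) \<and>
     (\<forall>x \<in> elts R. \<not> rel lt x x) \<and>
     (\<forall>x \<in> elts R. \<forall>y \<in> elts R. x = y \<or> rel lt x y \<or> rel lt y x) \<and>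
     (\<forall>x \<in> elts R. \<forall>y \<in> elts R. \<forall>z \<in> elts R.
        (rel lt x y \<and> rel lt y z \<longrightarrow> rel lt x z) \<and>
        (rel lt x y \<longrightarrow> rel lt (val2 add x z) (val2 add y z))) \<and>
     (\<forall>S. elts S \<subseteq> elts R \<and> elts S \<noteq> {} \<and>
          (\<exists>b \<in> elts R. \<forall>x \<in> elts S. \<not> rel lt b x) \<longrightarrow>
        (\<exists>b \<in> elts R. (\<forall>x \<in> elts S. \<not> rel lt b x) \<and>
           (\<forall>d \<in> elts R. (\<forall>x \<in> elts S. \<not> rel lt d x) \<longrightarrow> \<not> rel lt d b)))"

text \<open>
  An element of \<open>FS(x)\<close>, for a sequence \<open>x\<close> in \<open>(G, add)\<close> indexed by \<open>\<kappa>\<close>: for some natural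
  number \<open>n\<close>, \<open>e\<close> lists \<open>n + 1\<close> distinct indices \<open>e 0, \<dots>, e n\<close>, and \<open>t k\<close> is the partial sum
  \<open>x (e 0) + \<dots> + x (e k)\<close>.  Recall \<open>n + 1 = {0, \<dots>, n}\<close>.
\<close>

definition in_FS :: "'v \<Rightarrow> 'v \<Rightarrow> 'v \<Rightarrow> 'v \<Rightarrow> 'v \<Rightarrow> bool" where
  "in_FS G add \<kappa> x s \<longleftrightarrow>
     (\<exists>n \<in> elts omega. \<exists>e t.
        injects e (suc n) \<kappa> \<and> maps t (suc n) G \<and>
        val t empty_set = val x (val e empty_set) \<and>
        (\<forall>k \<in> elts n. val t (suc k) = val2 add (val t k) (val x (val e (suc k)))) \<and>
        s = val t n)"

definition arrow :: "'v \<Rightarrow> 'v \<Rightarrow> 'v \<Rightarrow> 'v \<Rightarrow> bool" where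
  "arrow G add \<kappa> \<theta> \<longleftrightarrow>
     (\<forall>c. maps c G \<theta> \<longrightarrow>
        (\<exists>x. injects x \<kappa> G \<and> (\<exists>i. \<forall>s. in_FS G add \<kappa> x s \<longrightarrow> val c s = i)))"

end

end

theory Submission
  imports Defs "HOL-Library.Nat_Bijection"
begin

text \<open>
  Fix a scale \<open>a > 0\<close>.  If the absolute values of \<open>x\<close> and \<open>y\<close> are in \<open>[a, 2 a)\<close>, then that of
  \<open>x + y\<close> is not: for equal signs \<open>\<bar>x + y\<bar> \<ge> 2 a\<close>, and for opposite signs \<open>\<bar>x + y\<bar> < a\<close>.  The nonzero
  reals are covered by the countably many sets \<open>{x. 2 ^ k \<le> \<bar>x\<bar> < 2 * 2 ^ k}\<close> with \<open>k\<close> an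
  integer, so it is enough to colour \<open>x\<close> by its \<open>k\<close> and to keep one further colour for \<open>0\<close>.  For
  the type of reals this is \<open>real_sum_free_colouring\<close>, where \<open>k\<close> is the floor of the binary
  logarithm.

  Inside a model of ZF the same colouring has to be an element of the model.  The model may have
  nonstandard natural numbers, and then the field is non-Archimedean when seen from outside, so
  that neither external logarithms nor external induction give elements of the model.  Sets of the
  model are obtained by separation for first-order formulas.  Three steps carry the proof.

  \<^item> Recursion on the \<open>\<omega>\<close> of the model (\<open>recursion\<close>).  Together with the fact that nonempty
    definable subsets of \<open>\<omega>\<close> have a unique first element (\<open>omega_least\<close>), this replaces the
    external integers.

  \<^item> A single sequence that meets all scales (\<open>sweeping_sequence_exists\<close>).  To have colours in
    \<open>\<omega>\<close>, the scales \<open>2 ^ k\<close> for positive and negative \<open>k\<close> must be enumerated together.  The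
    recursion runs through the pairs \<open>(w, w)\<close>, \<open>(2 w, w/2)\<close>, \<open>(w/2, 2 w)\<close>, \<open>(4 w, w/4)\<close>,
    \<open>(w/4, 4 w)\<close>, and so on, where \<open>w\<close> is any positive element; the first components are the
    scales.  Only the ordered additive group and halving are used for this.

  \<^item> The scales cover all positive elements (\<open>dyadic_cover\<close>).  This is the Archimedean property in
    the form \<open>no_bounded_doubling_set\<close>: a set of the model that contains a positive element and is
    closed under doubling has no upper bound, because half of a supremum would be a smaller bound.

  The colour of \<open>x \<noteq> 0\<close> is the successor of the first index whose scale fits \<open>x\<close>, and \<open>0\<close> is
  coloured by \<open>0\<close>.  A sequence of length two whose finite sums have one colour would give distinct
  \<open>x\<close> and \<open>y\<close> with \<open>x\<close>, \<open>y\<close> and \<open>x + y\<close> of one colour, so the failure of the partition relation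
  follows.
\<close>

section \<open>First-order definable predicates\<close>

context membership
begin

primrec rename :: "(nat \<Rightarrow> nat) \<Rightarrow> fm \<Rightarrow> fm" where
  "rename r (In i j) = In (r i) (r j)"
| "rename r (Eq i j) = Eq (r i) (r j)"
| "rename r (Neg p) = Neg (rename r p)"
| "rename r (Conj p q) = Conj (rename r p) (rename r q)"
| "rename r (All i p) = All (r i) (rename r p)"

lemma sat_rename:
  assumes "inj r"
  shows "sat s (rename r p) \<longleftrightarrow> sat (s \<circ> r) p"
proof (induction p arbitrary: s)
  case (All i p)
  have "s(r i := a) \<circ> r = (s \<circ> r)(i := a)" for a
    using assms by (auto simp: fun_eq_iff inj_eq)
  then show ?case using All by (simp del: comp_apply fun_upd_apply)
qed auto

text \<open>
  A valuation made of two halves: the values of the free variables sit at the even indices and the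
  values of the parameters at the odd ones.  Thus there is always room for more of either kind.
\<close>

definition mix :: "(nat \<Rightarrow> 'v) \<Rightarrow> (nat \<Rightarrow> 'v) \<Rightarrow> nat \<Rightarrow> 'v" where
  "mix s t i = (if even i then s (i div 2) else t (i div 2))"

lemma mix_simps [simp]: "mix s t (2 * i) = s i" "mix s t (Suc (2 * i)) = t i"
  by (simp_all add: mix_def)

lemma fun_eq_parityI:
  fixes f g :: "nat \<Rightarrow> 'v"
  assumes "\<And>i. f (2 * i) = g (2 * i)" "\<And>i. f (Suc (2 * i)) = g (Suc (2 * i))"
  shows "f = g"
proof
  fix i show "f i = g i"
    using assms by (cases "even i") (auto elim!: evenE oddE)
qed

text \<open>
  The predicates on environments that some first-order formula expresses, with parameters \<open>t\<close> from
  the structure.  Environments are read in de Bruijn style: entering a quantifier shifts all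
  variables up by one and puts the bound variable at index 0.  The closure rules below then show
  definability of a concrete predicate by plain resolution, with no formula ever written down.
\<close>

definition definable :: "((nat \<Rightarrow> 'v) \<Rightarrow> bool) \<Rightarrow> bool" where
  "definable P \<longleftrightarrow> (\<exists>p t. \<forall>s. P s \<longleftrightarrow> sat (mix s t) p)"

definition definable_fun :: "((nat \<Rightarrow> 'v) \<Rightarrow> 'v) \<Rightarrow> bool" where
  "definable_fun f \<longleftrightarrow> definable (\<lambda>s. s 0 = f (\<lambda>i. s (Suc i)))"

lemma definable_reindex:
  assumes "inj r" "definable P"
  shows "definable (\<lambda>s. P (\<lambda>i. s (r i)))"
proof -
  obtain p t where p: "\<And>s. P s \<longleftrightarrow> sat (mix s t) p"
    using assms(2) unfolding definable_def by blast
  \<comment> \<open>The reindexing applies to the free variables and leaves the parameters alone.\<close>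
  define r' where "r' i = (if even i then 2 * r (i div 2) else i)" for i
  have "inj r'"
  proof (rule injI)
    fix i j assume *: "r' i = r' j"
    then have "even i \<longleftrightarrow> even j"
      unfolding r'_def by (metis dvd_triv_left)
    moreover have "i div 2 = j div 2" if "even i" "even j"
      using * that assms(1) by (simp add: r'_def inj_eq)
    ultimately show "i = j"
      using * unfolding r'_def by (metis even_two_times_div_two)
  qed
  moreover have "mix s t \<circ> r' = mix (\<lambda>i. s (r i)) t" for s
    by (rule fun_eq_parityI) (simp_all add: r'_def mix_def)
  ultimately show ?thesis
    unfolding definable_def p by (metis sat_rename)
qed

lemma definable_const: "definable (\<lambda>s. b)"
proof (cases b)
  case True
  then show ?thesis unfolding definable_def by (intro exI[of _ "Eq 0 0"]) simp
next
  case False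
  then show ?thesis unfolding definable_def by (intro exI[of _ "Neg (Eq 0 0)"]) simp
qed

lemma definable_not:
  assumes "definable P"
  shows "definable (\<lambda>s. \<not> P s)"
  using assms unfolding definable_def by (metis sat.simps(3))

lemma definable_conj:
  assumes "definable P" "definable Q"
  shows "definable (\<lambda>s. P s \<and> Q s)"
proof -
  obtain p t where p: "\<And>s. P s \<longleftrightarrow> sat (mix s t) p"
    using assms(1) unfolding definable_def by blast
  obtain q u where q: "\<And>s. Q s \<longleftrightarrow> sat (mix s u) q"
    using assms(2) unfolding definable_def by blast
  \<comment> \<open>The parameters of the two formulas are interleaved in turn.\<close>
  define a where "a i = (if even i then i else 2 * i - 1)" for i :: nat
  define b where "b i = (if even i then i else 2 * i + 1)" for i :: nat
  have "inj a" "inj b"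
    unfolding inj_def a_def b_def by (presburger, presburger)
  have 1: "mix s (mix t u) \<circ> a = mix s t" for s
    proof (rule fun_eq_parityI)
    show "(mix s (mix t u) \<circ> a) (Suc (2 * i)) = mix s t (Suc (2 * i))" for i
      using mix_simps(2)[of s "mix t u" "2 * i"] by (simp add: a_def)
  qed (simp add: a_def)
  have 2: "mix s (mix t u) \<circ> b = mix s u" for s
    proof (rule fun_eq_parityI)
    show "(mix s (mix t u) \<circ> b) (Suc (2 * i)) = mix s u (Suc (2 * i))" for i
      using mix_simps(2)[of s "mix t u" "Suc (2 * i)"] by (simp add: b_def)
  qed (simp add: b_def)
  have "P s \<and> Q s \<longleftrightarrow> sat (mix s (mix t u)) (Conj (rename a p) (rename b q))" for s
    using p q 1 2 sat_rename[OF \<open>inj a\<close>] sat_rename[OF \<open>inj b\<close>] by simp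
  then show ?thesis unfolding definable_def by blast
qed

text \<open>
  A formula for the body has the bound variable at index 0 and the other variables two places too
  high.  The renaming \<open>r\<close> moves these back and puts the bound variable at the odd index 1, which
  it frees by moving the parameters up.
\<close>

lemma definable_all:
  assumes "definable (\<lambda>s. P (\<lambda>i. s (Suc i)) (s 0))"
  shows "definable (\<lambda>s. \<forall>a. P s a)"
proof -
  obtain p t where p: "\<And>s. P (\<lambda>i. s (Suc i)) (s 0) \<longleftrightarrow> sat (mix s t) p"
    using assms unfolding definable_def by blast
  define r where "r i = (if i = 0 then 1 else if even i then i - 2 else i + 2)" for i :: nat
  have "inj r"
    unfolding inj_def r_def by presburger
  define t' where "t' = case_nat (t 0) t"
  have *: "(mix s t')(1 := a) \<circ> r = mix (case_nat a s) t" for s a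
  proof (rule fun_eq_parityI)
    show "((mix s t')(1 := a) \<circ> r) (2 * i) = mix (case_nat a s) t (2 * i)" for i
      using mix_simps(1)[of "case_nat a s" t i] by (cases i) (simp_all add: r_def)
    show "((mix s t')(1 := a) \<circ> r) (Suc (2 * i)) = mix (case_nat a s) t (Suc (2 * i))" for i
      using mix_simps(2)[of s t' "Suc i"] by (simp add: r_def t'_def)
  qed
  have "(\<forall>a. P s a) \<longleftrightarrow> sat (mix s t') (All 1 (rename r p))" for s
    using p[of "case_nat _ s"] sat_rename[OF \<open>inj r\<close>] * by simp
  then show ?thesis unfolding definable_def by blast
qed

lemma definable_disj: "definable P \<Longrightarrow> definable Q \<Longrightarrow> definable (\<lambda>s. P s \<or> Q s)"
  using definable_not[OF definable_conj[OF definable_not definable_not]] by simp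

lemma definable_imp: "definable P \<Longrightarrow> definable Q \<Longrightarrow> definable (\<lambda>s. P s \<longrightarrow> Q s)"
  unfolding imp_conv_disj by (intro definable_disj definable_not)

lemma definable_iff: "definable P \<Longrightarrow> definable Q \<Longrightarrow> definable (\<lambda>s. P s \<longleftrightarrow> Q s)"
  unfolding iff_conv_conj_imp by (intro definable_conj definable_imp)

lemma definable_ex:
  assumes "definable (\<lambda>s. P (\<lambda>i. s (Suc i)) (s 0))"
  shows "definable (\<lambda>s. \<exists>a. P s a)"
  using definable_not[OF definable_all[of "\<lambda>s a. \<not> P s a"]] definable_not[OF assms] by simp

text \<open>
  The term \<open>f s\<close> is eliminated by \<open>\<exists>a. a = f s \<and> P s a\<close>; this is why definable functions need not
  be first-order terms.
\<close>

lemma definable_subst: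
  assumes "definable_fun f" "definable (\<lambda>s. P (\<lambda>i. s (Suc i)) (s 0))"
  shows "definable (\<lambda>s. P s (f s))"
proof -
  have "definable (\<lambda>s. \<exists>a. a = f s \<and> P s a)"
    using assms unfolding definable_fun_def by (intro definable_ex definable_conj)
  then show ?thesis by simp
qed

lemma definable_fun_shift:
  assumes "definable_fun f"
  shows "definable_fun (\<lambda>s. f (\<lambda>i. s (Suc i)))"
proof -
  \<comment> \<open>Index 0 holds the value of \<open>f\<close>; the new variable is inserted just above it.\<close>
  have "inj (case_nat 0 (\<lambda>i. i + 2))"
    by (auto simp: inj_def split: nat.split)
  from definable_reindex[OF this] assms show ?thesis
    unfolding definable_fun_def by fastforce
qed

lemma definable_fun_var: "definable_fun (\<lambda>s. s i)"
proof -
  have "s 0 = s (Suc i) \<longleftrightarrow> sat (mix s t) (Eq 0 (2 * Suc i))" for s t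
    by (simp add: mix_def)
  then show ?thesis unfolding definable_fun_def definable_def by blast
qed

lemma definable_fun_const: "definable_fun (\<lambda>s. c)"
proof -
  have "s 0 = c \<longleftrightarrow> sat (mix s (\<lambda>_. c)) (Eq 0 1)" for s
    by (simp add: mix_def)
  then show ?thesis unfolding definable_fun_def definable_def by blast
qed

lemma definable_binary:
  assumes "definable (\<lambda>s. P (s 0) (s 1))" "definable_fun f" "definable_fun g"
  shows "definable (\<lambda>s. P (f s) (g s))"
proof -
  \<comment> \<open>The second argument is substituted first, so it has to be the innermost variable.\<close>
  have "inj (\<lambda>i::nat. if i = 0 then 1 else if i = 1 then 0 else i)"
    by (auto simp: inj_def)
  from definable_reindex[OF this assms(1)] have "definable (\<lambda>s. P (s 1) (s 0))"
    by simp
  then have "definable (\<lambda>s. P (s (Suc 0)) (s 0))"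
    by simp
  then have "definable (\<lambda>s. P (s 0) (g (\<lambda>i. s (Suc i))))"
    by (rule definable_subst[OF definable_fun_shift[OF assms(3)], of "\<lambda>s a. P (s 0) a"])
  then show ?thesis
    by (rule definable_subst[OF assms(2), of "\<lambda>s a. P a (g s)"])
qed

lemma definable_mem:
  assumes "definable_fun f" "definable_fun g"
  shows "definable (\<lambda>s. f s \<in> elts (g s))"
proof (rule definable_binary[OF _ assms])
  have "s 0 \<in> elts (s 1) \<longleftrightarrow> sat (mix s t) (In 0 2)" for s t
    by (simp add: mix_def elts_def)
  then show "definable (\<lambda>s. s 0 \<in> elts (s 1))" unfolding definable_def by blast
qed

lemma definable_eq:
  assumes "definable_fun f" "definable_fun g"
  shows "definable (\<lambda>s. f s = g s)"
proof (rule definable_binary[OF _ assms])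
  have "s 0 = s 1 \<longleftrightarrow> sat (mix s t) (Eq 0 2)" for s t
    by (simp add: mix_def)
  then show "definable (\<lambda>s. s 0 = s 1)" unfolding definable_def by blast
qed

lemmas definable_logic = definable_const definable_not definable_conj definable_disj
  definable_imp definable_iff definable_all definable_ex definable_mem definable_eq
  definable_fun_var definable_fun_const

lemma definable_ball:
  assumes "definable_fun f" "definable (\<lambda>s. P (\<lambda>i. s (Suc i)) (s 0))"
  shows "definable (\<lambda>s. \<forall>a \<in> elts (f s). P s a)"
  unfolding Ball_def using assms by (intro definable_logic definable_fun_shift)

lemma definable_bex:
  assumes "definable_fun f" "definable (\<lambda>s. P (\<lambda>i. s (Suc i)) (s 0))"
  shows "definable (\<lambda>s. \<exists>a \<in> elts (f s). P s a)"
  unfolding Bex_def using assms by (intro definable_logic definable_fun_shift)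

lemma definable_funI:
  assumes "\<And>s y. y = f s \<longleftrightarrow> P s y" "definable (\<lambda>s. P (\<lambda>i. s (Suc i)) (s 0))"
  shows "definable_fun f"
  using assms unfolding definable_fun_def by simp

end


section \<open>Set theory inside a model of ZF\<close>

context zf_model
begin

lemma elts_inject: "elts x = elts y \<longleftrightarrow> x = y"
  using extensionality by blast

lemma the_elts:
  assumes "\<exists>z. elts z = A"
  shows "elts (THE z. elts z = A) = A"
  using assms by (metis (mono_tags, lifting) elts_inject theI_unique)

lemma separation_definable:
  assumes "definable (\<lambda>s. P (s 0))"
  shows "\<exists>z. elts z = {a \<in> elts x. P a}"
proof -
  obtain p t where p: "\<And>s. P (s 0) \<longleftrightarrow> sat (mix s t) p"
    using assms unfolding definable_def by blast
  have "(mix (\<lambda>_. x) t)(0 := a) = mix ((\<lambda>_. x)(0 := a)) t" for a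
    by (rule fun_eq_parityI) auto
  then have "P a \<longleftrightarrow> sat ((mix (\<lambda>_. x) t)(0 := a)) p" for a
    using p[of "(\<lambda>_. x)(0 := a)"] by simp
  then show ?thesis using separation by simp
qed

lemma elts_empty_set [simp]: "elts empty_set = {}"
proof -
  have "\<exists>z. elts z = {a \<in> elts undefined. False}"
    by (rule separation_definable) (rule definable_const)
  then show ?thesis unfolding empty_set_def by (intro the_elts) simp
qed

lemma elts_upair [simp]: "elts (upair x y) = {x, y}"
  unfolding upair_def by (rule the_elts[OF pairing])

lemma Un_exists: "\<exists>z. elts z = elts x \<union> elts y"
  using union[of "upair x y"] by simp

lemma elts_suc [simp]: "elts (suc x) = insert x (elts x)"
  unfolding suc_def using Un_exists[of "upair x x" x] by (intro the_elts) simp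

lemma is_inductive_iff: "is_inductive w \<longleftrightarrow> empty_set \<in> elts w \<and> (\<forall>y \<in> elts w. suc y \<in> elts w)"
  unfolding is_inductive_def by (metis elts_empty_set elts_inject elts_suc)

lemma upair_eq_iff: "upair a b = upair c d \<longleftrightarrow> a = c \<and> b = d \<or> a = d \<and> b = c"
  by (metis doubleton_eq_iff elts_inject elts_upair)

lemma opair_inject [simp]: "opair a b = opair c d \<longleftrightarrow> a = c \<and> b = d"
  unfolding opair_def by (auto simp: upair_eq_iff)

lemma suc_neq_empty [simp]: "suc x \<noteq> empty_set" "empty_set \<noteq> suc x"
  by (metis elts_empty_set elts_suc insert_not_empty)+

lemma mem_asym: "x \<in> elts y \<Longrightarrow> y \<notin> elts x"
  using foundation[of "upair x y"] by auto

lemma suc_inject [simp]: "suc x = suc y \<longleftrightarrow> x = y"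
  by (metis elts_suc insertE insertI1 mem_asym)

lemma definable_fun_upair:
  assumes "definable_fun f" "definable_fun g"
  shows "definable_fun (\<lambda>s. upair (f s) (g s))"
proof (rule definable_funI)
  show "y = upair (f s) (g s) \<longleftrightarrow> (\<forall>z. z \<in> elts y \<longleftrightarrow> z = f s \<or> z = g s)" for s y
    using elts_inject[of y "upair (f s) (g s)"] by auto
qed (intro definable_logic definable_fun_shift assms)

lemma definable_fun_opair:
  assumes "definable_fun f" "definable_fun g"
  shows "definable_fun (\<lambda>s. opair (f s) (g s))"
  unfolding opair_def by (intro definable_fun_upair assms)

lemma definable_fun_suc:
  assumes "definable_fun f"
  shows "definable_fun (\<lambda>s. suc (f s))"
proof (rule definable_funI)
  show "y = suc (f s) \<longleftrightarrow> (\<forall>z. z \<in> elts y \<longleftrightarrow> z = f s \<or> z \<in> elts (f s))" for s y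
    using elts_inject[of y "suc (f s)"] by auto
qed (intro definable_logic definable_fun_shift assms)

lemma definable_rel:
  assumes "definable_fun r" "definable_fun f" "definable_fun g"
  shows "definable (\<lambda>s. rel (r s) (f s) (g s))"
  unfolding rel_def by (intro definable_mem definable_fun_opair assms)

text \<open>
  The description \<open>val\<close> has no specified value where it does not denote, so it is not definable as a
  total operation.  Giving it a default value there makes it so.
\<close>

definition app :: "'v \<Rightarrow> 'v \<Rightarrow> 'v" where
  "app f x = (if \<exists>!y. rel f x y then val f x else x)"

lemma definable_fun_app:
  assumes "definable_fun f" "definable_fun g"
  shows "definable_fun (\<lambda>s. app (f s) (g s))"
proof (rule definable_funI)
  show "y = app (f s) (g s) \<longleftrightarrow>
      rel (f s) (g s) y \<and> (\<forall>z. rel (f s) (g s) z \<longrightarrow> z = y) \<or>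
      \<not> (\<exists>y. rel (f s) (g s) y \<and> (\<forall>z. rel (f s) (g s) z \<longrightarrow> z = y)) \<and> y = g s" for s y
    unfolding app_def val_def Ex1_def[symmetric]
    by (smt (verit, best) the1_equality)
qed (intro definable_logic definable_rel definable_fun_shift assms)

lemmas definable_intros = definable_logic definable_ball definable_bex definable_rel
  definable_fun_opair definable_fun_suc definable_fun_app

text \<open>
  With Kuratowski pairs, \<open>A \<times> B\<close> is cut out of the double power set of \<open>A \<union> B\<close>.
\<close>

lemma prod_exists: "\<exists>z. elts z = {opair x y | x y. x \<in> elts A \<and> y \<in> elts B}"
proof -
  obtain u where u: "elts u = elts A \<union> elts B" using Un_exists by blast
  obtain v where v: "elts v = {y. elts y \<subseteq> elts u}" using power_set by blast
  obtain w where w: "elts w = {y. elts y \<subseteq> elts v}" using power_set by blast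
  have "\<exists>z. elts z = {a \<in> elts w. \<exists>x \<in> elts A. \<exists>y \<in> elts B. a = opair x y}"
    by (rule separation_definable) (intro definable_intros)
  then obtain z where z: "elts z = {a \<in> elts w. \<exists>x \<in> elts A. \<exists>y \<in> elts B. a = opair x y}"
    by blast
  have "opair x y \<in> elts w" if "x \<in> elts A" "y \<in> elts B" for x y
    using that u v w unfolding opair_def by auto
  then have "elts z = {opair x y | x y. x \<in> elts A \<and> y \<in> elts B}"
    unfolding z by auto
  then show ?thesis by blast
qed

lemma val_eqI: "maps f A B \<Longrightarrow> x \<in> elts A \<Longrightarrow> rel f x y \<Longrightarrow> val f x = y"
  unfolding maps_def val_def by (metis the1_equality)

lemma maps_val:
  assumes "maps f A B" "x \<in> elts A"
  shows "rel f x (val f x)" "val f x \<in> elts B"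
proof -
  show *: "rel f x (val f x)"
    using assms unfolding maps_def val_def by (metis (mono_tags, lifting) theI')
  show "val f x \<in> elts B"
    using * assms(1) unfolding rel_def maps_def by auto
qed

lemma app_eq_val: "maps f A B \<Longrightarrow> x \<in> elts A \<Longrightarrow> app f x = val f x"
  unfolding maps_def app_def by auto

lemma function_exists:
  assumes "\<And>x. x \<in> elts A \<Longrightarrow> \<exists>!y. y \<in> elts B \<and> P x y"
    and "definable (\<lambda>s. P (s 0) (s 1))"
  shows "\<exists>f. maps f A B \<and> (\<forall>x \<in> elts A. P x (val f x))"
proof -
  obtain C where C: "elts C = {opair x y | x y. x \<in> elts A \<and> y \<in> elts B}"
    using prod_exists by blast
  have "\<exists>f. elts f = {a \<in> elts C. \<exists>x y. a = opair x y \<and> P x y}"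
    by (rule separation_definable) (intro definable_intros definable_binary[OF assms(2)])
  then obtain f where f: "elts f = {a \<in> elts C. \<exists>x y. a = opair x y \<and> P x y}" by blast
  have rel: "rel f x y \<longleftrightarrow> x \<in> elts A \<and> y \<in> elts B \<and> P x y" for x y
    unfolding rel_def f C by auto
  have maps: "maps f A B"
    unfolding maps_def rel using f C assms(1) by auto
  have "P x (val f x)" if "x \<in> elts A" for x
    using maps_val(1)[OF maps that] unfolding rel by blast
  then show ?thesis using maps by blast
qed

lemma elts_omega: "elts omega = {n. \<forall>v. is_inductive v \<longrightarrow> n \<in> elts v}"
proof -
  obtain w where w: "is_inductive w" using infinity by blast
  have "\<exists>z. elts z = {n \<in> elts w. \<forall>v. (empty_set \<in> elts v \<and> (\<forall>y \<in> elts v. suc y \<in> elts v)) \<longrightarrow> n \<in> elts v}"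
    by (rule separation_definable) (intro definable_intros)
  moreover have "{n \<in> elts w. \<forall>v. is_inductive v \<longrightarrow> n \<in> elts v} = {n. \<forall>v. is_inductive v \<longrightarrow> n \<in> elts v}"
    using w by blast
  ultimately show ?thesis
    unfolding omega_def is_inductive_iff[symmetric] by (intro the_elts) simp
qed

lemma empty_in_omega [simp]: "empty_set \<in> elts omega"
  by (simp add: elts_omega is_inductive_iff)

lemma suc_in_omega [simp]: "n \<in> elts omega \<Longrightarrow> suc n \<in> elts omega"
  by (simp add: elts_omega is_inductive_iff)

text \<open>
  Only definable predicates admit induction: in a nonstandard model, "standard" is a property
  that holds for 0 and passes to successors, but fails somewhere.
\<close>

lemma omega_induct:
  assumes "n \<in> elts omega" "definable (\<lambda>s. P (s 0))" "P empty_set"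
    and "\<And>m. m \<in> elts omega \<Longrightarrow> P m \<Longrightarrow> P (suc m)"
  shows "P n"
proof -
  obtain z where z: "elts z = {a \<in> elts omega. P a}"
    using separation_definable[OF assms(2)] by blast
  have "is_inductive z"
    unfolding is_inductive_iff z using assms(3,4) by auto
  then show ?thesis using assms(1) z by (auto simp: elts_omega)
qed

lemma empty_in_suc:
  assumes "n \<in> elts omega" shows "empty_set \<in> elts (suc n)"
  by (rule omega_induct[OF assms]) (intro definable_intros, auto)

lemma suc_in_suc:
  assumes "n \<in> elts omega" "m \<in> elts n" shows "suc m \<in> elts (suc n)"
proof -
  have "m \<in> elts n \<longrightarrow> suc m \<in> elts (suc n)"
    by (rule omega_induct[OF assms(1)]) (intro definable_intros, auto)
  then show ?thesis using assms by blast
qed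

text \<open>
  Induction on \<open>m\<close>; the steps are the two preceding lemmas, each an induction on \<open>n\<close>.
\<close>

lemma omega_linear:
  assumes "m \<in> elts omega" "n \<in> elts omega"
  shows "m \<in> elts n \<or> m = n \<or> n \<in> elts m"
proof (rule omega_induct[OF assms(1)])
  show "empty_set \<in> elts n \<or> empty_set = n \<or> n \<in> elts empty_set"
    using empty_in_suc[OF assms(2)] by auto
  show "suc k \<in> elts n \<or> suc k = n \<or> n \<in> elts (suc k)"
    if "k \<in> elts n \<or> k = n \<or> n \<in> elts k" for k
    using suc_in_suc[OF assms(2)] that by auto
qed (intro definable_intros)

text \<open>
  Foundation yields a minimal element, and linearity makes it the only one.
\<close>

lemma omega_least:
  assumes "\<exists>n \<in> elts omega. P n" "definable (\<lambda>s. P (s 0))"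
  shows "\<exists>!n. n \<in> elts omega \<and> P n \<and> (\<forall>m \<in> elts n. m \<in> elts omega \<longrightarrow> \<not> P m)"
proof -
  obtain z where z: "elts z = {a \<in> elts omega. P a}"
    using separation_definable[OF assms(2)] by blast
  then obtain n where "n \<in> elts z" "elts n \<inter> elts z = {}"
    using foundation[of z] assms(1) by blast
  then show ?thesis
    using z omega_linear by (intro ex1I[of _ n]) blast+
qed

text \<open>
  The graph of the sequence is the least subset \<open>F\<close> of \<open>\<omega> \<times> X\<close> that contains \<open>(0, x0)\<close> and is closed
  under \<open>(n, x) \<mapsto> (n + 1, G x)\<close>.  A pair that is neither \<open>(0, x0)\<close> nor the successor of another
  pair of \<open>F\<close> could be deleted without losing these properties, hence is not in \<open>F\<close> (the fact
  \<open>delete\<close>); so by induction \<open>F\<close> is single-valued.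
\<close>

lemma recursion:
  assumes x0: "x0 \<in> elts X" and G: "maps G X X"
  shows "\<exists>F. maps F omega X \<and> val F empty_set = x0 \<and>
    (\<forall>n \<in> elts omega. val F (suc n) = val G (val F n))"
proof -
  obtain T where T: "elts T = {opair x y | x y. x \<in> elts omega \<and> y \<in> elts X}"
    using prod_exists by blast
  define closed where "closed S \<longleftrightarrow> opair empty_set x0 \<in> elts S \<and>
      (\<forall>n \<in> elts omega. \<forall>x \<in> elts X. opair n x \<in> elts S \<longrightarrow> opair (suc n) (app G x) \<in> elts S)" for S
  have "\<exists>F. elts F = {t \<in> elts T. \<forall>S. closed S \<longrightarrow> t \<in> elts S}"
    unfolding closed_def by (rule separation_definable) (intro definable_intros)
  then obtain F where F: "elts F = {t \<in> elts T. \<forall>S. closed S \<longrightarrow> t \<in> elts S}" by blast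
  have app_in: "app G x \<in> elts X" if "x \<in> elts X" for x
    using that app_eq_val[OF G] maps_val(2)[OF G] by simp
  have rel_in: "n \<in> elts omega \<and> x \<in> elts X" if "rel F n x" for n x
    using that F T unfolding rel_def by auto
  have F0: "rel F empty_set x0"
    using F T x0 unfolding rel_def closed_def by auto
  have FS: "rel F (suc n) (app G x)" if "rel F n x" for n x
    using that rel_in[OF that] F T app_in unfolding rel_def closed_def by auto
  have delete: "\<not> rel F n x"
    if "opair n x \<noteq> opair empty_set x0" and
      "\<And>m y. rel F m y \<Longrightarrow> opair m y \<noteq> opair n x \<Longrightarrow> opair (suc m) (app G y) \<noteq> opair n x" for n x
  proof -
    have "\<exists>S. elts S = {t \<in> elts F. t \<noteq> opair n x}"
      by (rule separation_definable) (intro definable_intros)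
    then obtain S where S: "elts S = {t \<in> elts F. t \<noteq> opair n x}" by blast
    have "closed S"
      unfolding closed_def
    proof (intro conjI ballI impI)
      show "opair empty_set x0 \<in> elts S"
        using S F0 that(1)[symmetric] unfolding rel_def by simp
      fix m y assume "opair m y \<in> elts S"
      then have "rel F m y" "opair m y \<noteq> opair n x"
        using S unfolding rel_def by auto
      from FS[OF this(1)] that(2)[OF this]
      show "opair (suc m) (app G y) \<in> elts S"
        using S unfolding rel_def by simp
    qed
    then show ?thesis using F S unfolding rel_def by blast
  qed
  have unique: "\<exists>y. rel F n y \<and> (\<forall>z. rel F n z \<longrightarrow> z = y)" if "n \<in> elts omega" for n
  proof (rule omega_induct[OF that])
    show "\<exists>y. rel F empty_set y \<and> (\<forall>z. rel F empty_set z \<longrightarrow> z = y)"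
      using F0 delete[of empty_set] by auto
    show "\<exists>y. rel F (suc m) y \<and> (\<forall>z. rel F (suc m) z \<longrightarrow> z = y)"
      if IH: "\<exists>y. rel F m y \<and> (\<forall>z. rel F m z \<longrightarrow> z = y)" for m
    proof -
      obtain y where y: "rel F m y" "\<And>z. rel F m z \<Longrightarrow> z = y" using IH by blast
      have "z = app G y" if "rel F (suc m) z" for z
        using delete[of "suc m" z] that y(2) by fastforce
      then show ?thesis using FS y(1) by blast
    qed
  qed (intro definable_intros)
  have maps: "maps F omega X"
    unfolding maps_def using unique F T by (auto simp: Ex1_def)
  show ?thesis
  proof (intro exI conjI ballI)
    show "maps F omega X" by fact
    show "val F empty_set = x0" by (rule val_eqI[OF maps empty_in_omega F0])
    show "val F (suc n) = val G (val F n)" if n: "n \<in> elts omega" for n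
      using val_eqI[OF maps _ FS[OF maps_val(1)[OF maps n]]] n maps_val(2)[OF maps n] app_eq_val[OF G]
      by simp
  qed
qed

end


section \<open>The ordered additive group of the reals of a model\<close>

locale zf_reals = zf_model mem for mem :: "'v \<Rightarrow> 'v \<Rightarrow> bool" +
  fixes R add mult lt :: 'v
  assumes reals: "complete_ordered_field R add mult lt"
begin

text \<open>
  Addition by means of \<open>app\<close> may occur in definable predicates; on \<open>R\<close> it is \<open>val2 add\<close>.
\<close>

definition plus :: "'v \<Rightarrow> 'v \<Rightarrow> 'v" (infixl "\<oplus>" 65) where
  "x \<oplus> y = app add (opair x y)"

abbreviation less :: "'v \<Rightarrow> 'v \<Rightarrow> bool" (infix "\<prec>" 50) where
  "x \<prec> y \<equiv> rel lt x y"

definition zero :: 'v ("\<zero>") where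
  "\<zero> = (THE u. u \<in> elts R \<and> (\<forall>x \<in> elts R. x \<oplus> u = x))"

lemma definable_fun_plus:
  "definable_fun f \<Longrightarrow> definable_fun g \<Longrightarrow> definable_fun (\<lambda>s. f s \<oplus> g s)"
  unfolding plus_def by (intro definable_intros)

lemma val2_closed: "binop f A \<Longrightarrow> x \<in> elts A \<Longrightarrow> y \<in> elts A \<Longrightarrow> val2 f x y \<in> elts A"
proof -
  assume *: "binop f A" "x \<in> elts A" "y \<in> elts A"
  then have "rel f (opair x y) (val2 f x y)"
    unfolding binop_def val2_def val_def by (metis (mono_tags, lifting) theI')
  then show ?thesis using *(1) unfolding binop_def rel_def by auto
qed

lemma shows binop_add: "binop add R" and binop_mult: "binop mult R"
    and val2_commute: "\<forall>x \<in> elts R. \<forall>y \<in> elts R.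
      val2 add x y = val2 add y x \<and> val2 mult x y = val2 mult y x"
    and val2_assoc_distrib: "\<forall>x \<in> elts R. \<forall>y \<in> elts R. \<forall>z \<in> elts R.
      val2 add (val2 add x y) z = val2 add x (val2 add y z) \<and>
      val2 mult (val2 mult x y) z = val2 mult x (val2 mult y z) \<and>
      val2 mult x (val2 add y z) = val2 add (val2 mult x y) (val2 mult x z)"
    and neutral_elements: "\<exists>u \<in> elts R. \<exists>e \<in> elts R. u \<noteq> e \<and>
      (\<forall>x \<in> elts R. val2 add x u = x \<and> val2 mult x e = x \<and>
         (\<exists>y \<in> elts R. val2 add x y = u) \<and>
         (x \<noteq> u \<longrightarrow> (\<exists>y \<in> elts R. val2 mult x y = e))) \<and>
      (\<forall>x \<in> elts R. \<forall>y \<in> elts R. u \<prec> x \<and> u \<prec> y \<longrightarrow> u \<prec> val2 mult x y)"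
    and irreflexive: "\<forall>x \<in> elts R. \<not> x \<prec> x"
    and linear: "\<forall>x \<in> elts R. \<forall>y \<in> elts R. x = y \<or> x \<prec> y \<or> y \<prec> x"
    and transitive_translation: "\<forall>x \<in> elts R. \<forall>y \<in> elts R. \<forall>z \<in> elts R.
      (x \<prec> y \<and> y \<prec> z \<longrightarrow> x \<prec> z) \<and> (x \<prec> y \<longrightarrow> val2 add x z \<prec> val2 add y z)"
    and complete: "\<forall>S. elts S \<subseteq> elts R \<and> elts S \<noteq> {} \<and>
        (\<exists>b \<in> elts R. \<forall>x \<in> elts S. \<not> b \<prec> x) \<longrightarrow>
      (\<exists>b \<in> elts R. (\<forall>x \<in> elts S. \<not> b \<prec> x) \<and>
         (\<forall>d \<in> elts R. (\<forall>x \<in> elts S. \<not> d \<prec> x) \<longrightarrow> \<not> d \<prec> b))"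
  by (insert reals[unfolded complete_ordered_field_def], (elim conjE, assumption)+)

lemma plus_eq_val2: "x \<in> elts R \<Longrightarrow> y \<in> elts R \<Longrightarrow> x \<oplus> y = val2 add x y"
  using binop_add unfolding binop_def plus_def app_def val2_def by auto

lemma plus_closed [simp]: "x \<in> elts R \<Longrightarrow> y \<in> elts R \<Longrightarrow> x \<oplus> y \<in> elts R"
  using val2_closed[OF binop_add] by (simp add: plus_eq_val2)

lemma plus_commute: "x \<in> elts R \<Longrightarrow> y \<in> elts R \<Longrightarrow> x \<oplus> y = y \<oplus> x"
  using val2_commute plus_eq_val2 by metis

lemma plus_assoc:
  assumes "x \<in> elts R" "y \<in> elts R" "z \<in> elts R"
  shows "(x \<oplus> y) \<oplus> z = x \<oplus> (y \<oplus> z)"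
proof -
  have "val2 add (val2 add x y) z = val2 add x (val2 add y z)"
    using assms val2_assoc_distrib by blast
  then show ?thesis
    using assms plus_closed by (metis plus_eq_val2)
qed

lemma less_irrefl: "x \<in> elts R \<Longrightarrow> \<not> x \<prec> x"
  using irreflexive by blast

lemma less_linear: "x \<in> elts R \<Longrightarrow> y \<in> elts R \<Longrightarrow> x = y \<or> x \<prec> y \<or> y \<prec> x"
  using linear by blast

lemma less_trans:
  "x \<in> elts R \<Longrightarrow> y \<in> elts R \<Longrightarrow> z \<in> elts R \<Longrightarrow> x \<prec> y \<Longrightarrow> y \<prec> z \<Longrightarrow> x \<prec> z"
  using transitive_translation by blast

lemma plus_less_mono1:
  assumes "x \<in> elts R" "y \<in> elts R" "z \<in> elts R" "x \<prec> y"
  shows "x \<oplus> z \<prec> y \<oplus> z"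
proof -
  have "val2 add x z \<prec> val2 add y z"
    using assms transitive_translation by blast
  then show ?thesis using assms by (simp add: plus_eq_val2)
qed

lemma supremum_exists:
  assumes "elts S \<subseteq> elts R" "elts S \<noteq> {}" "b \<in> elts R" "\<And>x. x \<in> elts S \<Longrightarrow> \<not> b \<prec> x"
  obtains c where "c \<in> elts R" "\<And>x. x \<in> elts S \<Longrightarrow> \<not> c \<prec> x"
    "\<And>d. d \<in> elts R \<Longrightarrow> (\<And>x. x \<in> elts S \<Longrightarrow> \<not> d \<prec> x) \<Longrightarrow> \<not> d \<prec> c"
proof -
  have "\<exists>b \<in> elts R. (\<forall>x \<in> elts S. \<not> b \<prec> x) \<and>
           (\<forall>d \<in> elts R. (\<forall>x \<in> elts S. \<not> d \<prec> x) \<longrightarrow> \<not> d \<prec> b)"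
    using complete[THEN spec, of S, THEN mp] assms by blast
  then show ?thesis using that by blast
qed

lemma field_facts:
  obtains u e where "u \<in> elts R" "e \<in> elts R" "u \<noteq> e"
    "\<And>x. x \<in> elts R \<Longrightarrow> x \<oplus> u = x"
    "\<And>x. x \<in> elts R \<Longrightarrow> \<exists>y \<in> elts R. x \<oplus> y = u"
    "\<And>x. x \<in> elts R \<Longrightarrow> val2 mult x e = x"
    "\<And>x. x \<in> elts R \<Longrightarrow> x \<noteq> u \<Longrightarrow> \<exists>y \<in> elts R. val2 mult x y = e"
proof -
  obtain u e where ue: "u \<in> elts R" "e \<in> elts R" "u \<noteq> e"
    and *: "\<And>x. x \<in> elts R \<Longrightarrow> val2 add x u = x \<and> val2 mult x e = x \<and>
           (\<exists>y \<in> elts R. val2 add x y = u) \<and>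
           (x \<noteq> u \<longrightarrow> (\<exists>y \<in> elts R. val2 mult x y = e))"
    using neutral_elements by blast
  show ?thesis
  proof (rule that[OF ue])
    fix x assume x: "x \<in> elts R"
    show "x \<oplus> u = x" using *[OF x] x ue by (simp add: plus_eq_val2)
    show "\<exists>y \<in> elts R. x \<oplus> y = u" using *[OF x] x by (auto simp: plus_eq_val2)
    show "val2 mult x e = x" using *[OF x] by blast
    show "\<exists>y \<in> elts R. val2 mult x y = e" if "x \<noteq> u" using *[OF x] that by blast
  qed
qed

lemma zero_eqI:
  assumes "u \<in> elts R" "\<And>x. x \<in> elts R \<Longrightarrow> x \<oplus> u = x"
  shows "\<zero> = u"
  unfolding zero_def using assms plus_commute by (intro the_equality) metis+

lemma zero_closed [simp]: "\<zero> \<in> elts R"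
  and plus_zero [simp]: "x \<in> elts R \<Longrightarrow> x \<oplus> \<zero> = x"
  and minus_exists: "x \<in> elts R \<Longrightarrow> \<exists>y \<in> elts R. x \<oplus> y = \<zero>"
  by (metis field_facts zero_eqI)+

lemma zero_plus [simp]: "x \<in> elts R \<Longrightarrow> \<zero> \<oplus> x = x"
  by (metis plus_commute plus_zero zero_closed)

lemma plus_left_cancel:
  assumes "x \<in> elts R" "y \<in> elts R" "z \<in> elts R" "x \<oplus> y = x \<oplus> z"
  shows "y = z"
  using assms by (metis minus_exists plus_assoc plus_commute zero_plus)

lemma less_not_less_trans:
  "x \<in> elts R \<Longrightarrow> y \<in> elts R \<Longrightarrow> z \<in> elts R \<Longrightarrow> x \<prec> y \<Longrightarrow> \<not> z \<prec> y \<Longrightarrow> x \<prec> z"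
  using less_linear less_trans by metis

lemma not_less_trans:
  "x \<in> elts R \<Longrightarrow> y \<in> elts R \<Longrightarrow> z \<in> elts R \<Longrightarrow> \<not> y \<prec> x \<Longrightarrow> \<not> z \<prec> y \<Longrightarrow> \<not> z \<prec> x"
  using less_not_less_trans by blast

lemma plus_less_mono2:
  "x \<in> elts R \<Longrightarrow> y \<in> elts R \<Longrightarrow> z \<in> elts R \<Longrightarrow> x \<prec> y \<Longrightarrow> z \<oplus> x \<prec> z \<oplus> y"
  by (metis plus_less_mono1 plus_commute)

lemma plus_mono:
  assumes "a \<in> elts R" "b \<in> elts R" "x \<in> elts R" "y \<in> elts R" "\<not> x \<prec> a" "\<not> y \<prec> b"
  shows "\<not> x \<oplus> y \<prec> a \<oplus> b"
proof -
  have "\<not> x \<oplus> b \<prec> a \<oplus> b"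
    using assms less_linear[of x a] plus_less_mono1 less_trans less_irrefl plus_closed by metis
  moreover have "\<not> x \<oplus> y \<prec> x \<oplus> b"
    using assms less_linear[of y b] plus_less_mono2 less_trans less_irrefl plus_closed by metis
  ultimately show ?thesis
    using assms not_less_trans by (meson plus_closed)
qed

lemma double_less_iff:
  assumes "x \<in> elts R" "y \<in> elts R"
  shows "x \<oplus> x \<prec> y \<oplus> y \<longleftrightarrow> x \<prec> y"
  using assms plus_mono[of y y x x] plus_less_mono1[of x y x] plus_less_mono2[of x y y] less_trans
  by (meson plus_closed)

lemma plus_pos: "x \<in> elts R \<Longrightarrow> y \<in> elts R \<Longrightarrow> \<zero> \<prec> x \<Longrightarrow> \<zero> \<prec> y \<Longrightarrow> \<zero> \<prec> x \<oplus> y"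
  by (metis less_trans plus_closed plus_less_mono2 plus_zero zero_closed)

lemma less_double: "x \<in> elts R \<Longrightarrow> \<zero> \<prec> x \<Longrightarrow> x \<prec> x \<oplus> x"
  by (metis plus_less_mono2 plus_zero zero_closed)

text \<open>
  The only use of multiplication: \<open>1 + 1\<close> is not zero in an ordered field, and its inverse \<open>t\<close>
  satisfies \<open>x t + x t = x\<close>.
\<close>

lemma half_exists:
  assumes x: "x \<in> elts R" obtains h where "h \<in> elts R" "h \<oplus> h = x"
proof -
  obtain u e where ue: "u \<in> elts R" "e \<in> elts R" "u \<noteq> e"
    and add_u: "\<And>x. x \<in> elts R \<Longrightarrow> x \<oplus> u = x"
    and mult_e: "\<And>x. x \<in> elts R \<Longrightarrow> val2 mult x e = x"
    and inverse: "\<And>x. x \<in> elts R \<Longrightarrow> x \<noteq> u \<Longrightarrow> \<exists>y \<in> elts R. val2 mult x y = e"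
    by (rule field_facts) blast
  have u: "u = \<zero>" using zero_eqI[OF ue(1) add_u] by simp
  have distrib: "val2 mult a (b \<oplus> c) = val2 mult a b \<oplus> val2 mult a c"
    if "a \<in> elts R" "b \<in> elts R" "c \<in> elts R" for a b c
    using val2_assoc_distrib that val2_closed[OF binop_mult] by (simp add: plus_eq_val2)
  have "e \<oplus> e \<noteq> \<zero>"
    using double_less_iff[of e "\<zero>"] double_less_iff[of "\<zero>" e] ue u less_linear[of e "\<zero>"]
    by (metis less_irrefl plus_zero)
  then obtain t where t: "t \<in> elts R" "val2 mult (e \<oplus> e) t = e"
    using inverse[of "e \<oplus> e"] ue u by auto
  have "t \<oplus> t = val2 mult t (e \<oplus> e)"
    using distrib[of t e e] mult_e t ue by simp
  also have "\<dots> = e"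
    using t ue val2_commute by simp
  finally have "val2 mult x t \<oplus> val2 mult x t = x"
    using distrib[of x t t] mult_e x t by simp
  then show ?thesis
    using that val2_closed[OF binop_mult x t(1)] by blast
qed

lemma half_unique: "x \<in> elts R \<Longrightarrow> y \<in> elts R \<Longrightarrow> x \<oplus> x = y \<oplus> y \<Longrightarrow> x = y"
  by (metis double_less_iff less_irrefl less_linear plus_closed)

lemma half_pos_less:
  assumes "h \<in> elts R" "\<zero> \<prec> h \<oplus> h"
  shows "\<zero> \<prec> h" "h \<prec> h \<oplus> h"
proof -
  show "\<zero> \<prec> h" using double_less_iff[of "\<zero>" h] assms by simp
  then show "h \<prec> h \<oplus> h" using less_double assms by simp
qed

text \<open>
  If \<open>c\<close> is the supremum of \<open>S\<close>, then \<open>c > 0\<close>, and \<open>c / 2\<close> is again an upper bound because \<open>2 x \<le> c\<close>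
  for all \<open>x\<close> in \<open>S\<close>.  The set \<open>S\<close> must be an element of the model; this is what makes the lemma
  hold in models whose reals are not Archimedean from outside.
\<close>

lemma no_bounded_doubling_set:
  assumes S: "elts S \<subseteq> elts R" and s: "s \<in> elts S" "\<zero> \<prec> s"
    and double: "\<And>x. x \<in> elts S \<Longrightarrow> x \<oplus> x \<in> elts S"
    and b: "b \<in> elts R" "\<And>x. x \<in> elts S \<Longrightarrow> \<not> b \<prec> x"
  shows False
proof -
  obtain c where c: "c \<in> elts R" "\<And>x. x \<in> elts S \<Longrightarrow> \<not> c \<prec> x"
    "\<And>d. d \<in> elts R \<Longrightarrow> (\<And>x. x \<in> elts S \<Longrightarrow> \<not> d \<prec> x) \<Longrightarrow> \<not> d \<prec> c"
    using supremum_exists[OF S _ b] s by blast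
  obtain h where h: "h \<in> elts R" "h \<oplus> h = c" using half_exists[OF c(1)] .
  have "\<zero> \<prec> c"
    using less_not_less_trans[OF zero_closed _ c(1)] c(2)[OF s(1)] s S by blast
  then have "h \<prec> c" using half_pos_less[OF h(1)] h(2) by simp
  moreover have "\<not> h \<prec> x" if "x \<in> elts S" for x
    using double_less_iff[of h x] c(2)[OF double[OF that]] h that S by auto
  ultimately show False using c(3) h(1) by blast
qed


section \<open>The colouring inside the model\<close>

text \<open>
  This is \<open>a \<le> \<bar>x\<bar> < 2 a\<close>; the absolute value \<open>y\<close> is described by \<open>y = x\<close> or \<open>y = - x\<close> to keep the
  condition first-order.
\<close>

definition in_scale :: "'v \<Rightarrow> 'v \<Rightarrow> bool" where
  "in_scale a x \<longleftrightarrow> (\<exists>y \<in> elts R. (y = x \<or> y \<oplus> x = \<zero>) \<and> \<not> y \<prec> a \<and> y \<prec> a \<oplus> a)"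

text \<open>
  Let \<open>p\<close>, \<open>q\<close>, \<open>r\<close> be the absolute values of \<open>x\<close>, \<open>y\<close>, \<open>x + y\<close>.  Whatever the signs, either one of
  the three is the sum of the other two, or their sum is zero.  The former is excluded because a sum
  of two is at least \<open>2 a\<close>, the latter because all three are positive.
\<close>

lemma in_scale_sum_free:
  assumes a: "a \<in> elts R" "\<zero> \<prec> a" and x: "x \<in> elts R" and y: "y \<in> elts R"
    and "in_scale a x" "in_scale a y"
  shows "\<not> in_scale a (x \<oplus> y)"
proof
  assume "in_scale a (x \<oplus> y)"
  with assms(5,6) obtain p q r where
    R: "p \<in> elts R" "q \<in> elts R" "r \<in> elts R" and
    p: "p = x \<or> p \<oplus> x = \<zero>" "\<not> p \<prec> a" "p \<prec> a \<oplus> a" and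
    q: "q = y \<or> q \<oplus> y = \<zero>" "\<not> q \<prec> a" "q \<prec> a \<oplus> a" and
    r: "r = x \<oplus> y \<or> r \<oplus> (x \<oplus> y) = \<zero>" "\<not> r \<prec> a" "r \<prec> a \<oplus> a"
    unfolding in_scale_def by blast
  have pos: "\<zero> \<prec> p" "\<zero> \<prec> q" "\<zero> \<prec> r"
    using less_not_less_trans[OF zero_closed a(1)] R p(2) q(2) r(2) a(2) by blast+
  have large: "i \<oplus> j \<noteq> k" if "i \<in> elts R" "j \<in> elts R" "\<not> i \<prec> a" "\<not> j \<prec> a" "k \<prec> a \<oplus> a" for i j k
    using plus_mono[OF a(1) a(1) that(1,2,3,4)] that(5) by blast
  have "p \<oplus> q \<noteq> r" "p \<oplus> r \<noteq> q" "q \<oplus> r \<noteq> p"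
    using large R p(2,3) q(2,3) r(2,3) by blast+
  moreover have "r \<oplus> (p \<oplus> q) \<noteq> \<zero>"
    using plus_pos[OF R(3) plus_closed[OF R(1,2)] pos(3) plus_pos[OF R(1,2) pos(1,2)]]
      less_irrefl[OF zero_closed] by auto
  ultimately show False
    using p(1) q(1) r(1) R x y
    by (metis plus_assoc plus_commute plus_left_cancel plus_closed zero_plus)
qed

lemma absolute_value_exists:
  assumes "x \<in> elts R" "x \<noteq> \<zero>"
  obtains y where "y \<in> elts R" "y = x \<or> y \<oplus> x = \<zero>" "\<zero> \<prec> y"
proof (cases "\<zero> \<prec> x")
  case False
  then have "x \<prec> \<zero>" using less_linear[of x "\<zero>"] assms by auto
  obtain y where "y \<in> elts R" "x \<oplus> y = \<zero>" using minus_exists assms(1) by blast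
  then show ?thesis
    using that[of y] plus_less_mono1[OF assms(1) zero_closed, of y] \<open>x \<prec> \<zero>\<close> plus_commute assms(1) by simp
qed (use that assms in blast)

lemma positive_exists: obtains w where "w \<in> elts R" "\<zero> \<prec> w"
proof -
  obtain u e where "u \<in> elts R" "e \<in> elts R" "u \<noteq> e" by (rule field_facts) blast
  then obtain x where "x \<in> elts R" "x \<noteq> \<zero>" by metis
  then show ?thesis using absolute_value_exists that by metis
qed

text \<open>
  \<open>F\<close> enumerates pairs, starting from \<open>(w, w)\<close>.  A pair in descending order is swapped; any other
  pair \<open>(p, q)\<close> is followed by \<open>(2 q, p / 2)\<close>, here with \<open>p = 2 h\<close>.  Thus for each \<open>k\<close> both
  \<open>2\<^sup>k w\<close> and \<open>w / 2\<^sup>k\<close> occur as first components.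
\<close>

definition sweeps :: "'v \<Rightarrow> 'v \<Rightarrow> bool" where
  "sweeps F w \<longleftrightarrow> rel F empty_set (opair w w) \<and>
     (\<forall>n \<in> elts omega. \<forall>p \<in> elts R. \<forall>q \<in> elts R.
        rel F n (opair p q) \<and> q \<prec> p \<longrightarrow> rel F (suc n) (opair q p)) \<and>
     (\<forall>n \<in> elts omega. \<forall>h \<in> elts R. \<forall>q \<in> elts R.
        rel F n (opair (h \<oplus> h) q) \<and> \<not> q \<prec> h \<oplus> h \<longrightarrow> rel F (suc n) (opair (q \<oplus> q) h))"

lemma sweeping_sequence_exists:
  assumes w: "w \<in> elts R"
  shows "\<exists>F X. maps F omega X \<and> sweeps F w"
proof -
  obtain X where X: "elts X = {opair p q | p q. p \<in> elts R \<and> q \<in> elts R}"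
    using prod_exists by blast
  define step where "step s t \<longleftrightarrow> (\<exists>p \<in> elts R. \<exists>q \<in> elts R. \<exists>h \<in> elts R. p = h \<oplus> h \<and> s = opair p q \<and>
      (q \<prec> p \<and> t = opair q p \<or> \<not> q \<prec> p \<and> t = opair (q \<oplus> q) h))" for s t
  have step_iff: "step (opair (h \<oplus> h) q) t \<longleftrightarrow>
      t = (if q \<prec> h \<oplus> h then opair q (h \<oplus> h) else opair (q \<oplus> q) h)"
    if h: "h \<in> elts R" and q: "q \<in> elts R" for h q t
  proof
    assume "step (opair (h \<oplus> h) q) t"
    then obtain h' where h': "h' \<in> elts R" "h \<oplus> h = h' \<oplus> h'"
      "q \<prec> h \<oplus> h \<and> t = opair q (h \<oplus> h) \<or> \<not> q \<prec> h \<oplus> h \<and> t = opair (q \<oplus> q) h'"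
      unfolding step_def by auto
    from half_unique[OF h h'(1,2)] h'(3)
    show "t = (if q \<prec> h \<oplus> h then opair q (h \<oplus> h) else opair (q \<oplus> q) h)" by auto
  next
    assume "t = (if q \<prec> h \<oplus> h then opair q (h \<oplus> h) else opair (q \<oplus> q) h)"
    then show "step (opair (h \<oplus> h) q) t"
      unfolding step_def using h q
      by (intro bexI[of _ "h \<oplus> h"] bexI[of _ q] bexI[of _ h]) auto
  qed
  have "\<exists>!t. t \<in> elts X \<and> step s t" if "s \<in> elts X" for s
  proof -
    obtain p q where pq: "p \<in> elts R" "q \<in> elts R" "s = opair p q" using \<open>s \<in> elts X\<close> X by auto
    obtain h where h: "h \<in> elts R" "h \<oplus> h = p" using half_exists[OF pq(1)] .
    show ?thesis
      using step_iff[OF h(1) pq(2)] h pq X by auto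
  qed
  moreover have "definable (\<lambda>s. step (s 0) (s 1))"
    unfolding step_def by (intro definable_intros definable_fun_plus)
  ultimately obtain G where G: "maps G X X" "\<And>s. s \<in> elts X \<Longrightarrow> step s (val G s)"
    using function_exists[of X X step] by blast
  have "opair w w \<in> elts X" using X w by auto
  from recursion[OF this G(1)] obtain F where F: "maps F omega X" "val F empty_set = opair w w"
    "\<And>n. n \<in> elts omega \<Longrightarrow> val F (suc n) = val G (val F n)" by blast
  have rel: "rel F n s \<longleftrightarrow> s = val F n" if "n \<in> elts omega" for n s
    using val_eqI[OF F(1) that] maps_val(1)[OF F(1) that] by blast
  have step: "step s (val F (suc n))" if "n \<in> elts omega" "rel F n s" for n s
    using that F(3) G(2) rel maps_val(2)[OF F(1)] by simp
  have "sweeps F w"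
    unfolding sweeps_def
  proof (intro conjI ballI impI; (elim conjE)?)
    show "rel F empty_set (opair w w)"
      using rel F(2) by simp
    show "rel F (suc n) (opair q p)"
      if "n \<in> elts omega" and p: "p \<in> elts R" and "q \<in> elts R" "rel F n (opair p q)" "q \<prec> p" for n p q
    proof -
      obtain h where h: "h \<in> elts R" "h \<oplus> h = p" using half_exists[OF p] .
      show ?thesis
        using step[OF that(1,4)] step_iff[OF h(1) that(3)] that(1,5) rel[of "suc n"]
        unfolding h(2) by simp
    qed
    show "rel F (suc n) (opair (q \<oplus> q) h)"
      if "n \<in> elts omega" "h \<in> elts R" "q \<in> elts R"
        "rel F n (opair (h \<oplus> h) q)" "\<not> q \<prec> h \<oplus> h" for n h q
      using step[OF that(1,4)] step_iff[OF that(2,3)] that(1,5) rel[of "suc n"] by simp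
  qed
  then show ?thesis using F(1) by blast
qed

text \<open>
  Suppose that \<open>x\<close> lies in no interval \<open>[p, 2 p)\<close> with \<open>p\<close> a positive first component.  Call a pair \<open>(p, q)\<close>
  of the sequence ascending if \<open>p \<le> q\<close>.  An ascending pair \<open>(2 h, q)\<close> leads to \<open>(2 q, h)\<close> and then to
  the ascending pair \<open>(h, 2 q)\<close>.  If \<open>x \<ge> w\<close>, then the second components \<open>q\<close> of ascending pairs with
  \<open>2 q \<le> x\<close> are closed under doubling, since \<open>x\<close> misses \<open>[2 q, 4 q)\<close>.  If \<open>x < w\<close>, then the lower
  bounds of all first components \<open>p > x\<close> of ascending pairs are closed under doubling, since \<open>x\<close>
  misses \<open>[h, 2 h)\<close>, so that \<open>2 h > x\<close> forces \<open>h > x\<close>.  Both sets are bounded and contain a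
  positive element, \<open>w\<close> and \<open>x\<close> respectively.
\<close>

lemma dyadic_cover:
  assumes w: "w \<in> elts R" "\<zero> \<prec> w"
    and sweeps: "sweeps F w"
    and x: "x \<in> elts R" "\<zero> \<prec> x"
  shows "\<exists>n \<in> elts omega. \<exists>p \<in> elts R. \<exists>q \<in> elts R.
    rel F n (opair p q) \<and> \<zero> \<prec> p \<and> \<not> x \<prec> p \<and> x \<prec> p \<oplus> p"
proof (rule ccontr)
  note start = sweeps[unfolded sweeps_def, THEN conjunct1]
  have swap: "rel F (suc n) (opair q p)"
    if "n \<in> elts omega" "p \<in> elts R" "q \<in> elts R" "rel F n (opair p q)" "q \<prec> p" for n p q
    using sweeps that unfolding sweeps_def by blast
  have spread: "rel F (suc n) (opair (q \<oplus> q) h)"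
    if "n \<in> elts omega" "h \<in> elts R" "q \<in> elts R" "rel F n (opair (h \<oplus> h) q)" "\<not> q \<prec> h \<oplus> h" for n h q
    using sweeps that unfolding sweeps_def by blast
  assume "\<not> ?thesis"
  then have missed: "\<not> x \<prec> p \<oplus> p"
    if "n \<in> elts omega" "p \<in> elts R" "q \<in> elts R" "rel F n (opair p q)" "\<zero> \<prec> p" "\<not> x \<prec> p" for n p q
    using that by blast
  have next_pair: "rel F (suc n) (opair (q \<oplus> q) h) \<and> rel F (suc (suc n)) (opair h (q \<oplus> q)) \<and>
      \<not> q \<oplus> q \<prec> h \<and> \<zero> \<prec> h \<and> \<zero> \<prec> q \<and> \<zero> \<prec> q \<oplus> q"
    if n: "n \<in> elts omega" and h: "h \<in> elts R" and q: "q \<in> elts R" and F: "rel F n (opair (h \<oplus> h) q)"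
      and le: "\<not> q \<prec> h \<oplus> h" and pos: "\<zero> \<prec> h \<oplus> h" for n h q
  proof -
    have hpos: "\<zero> \<prec> h" "h \<prec> h \<oplus> h" using half_pos_less[OF h pos] .
    have qpos: "\<zero> \<prec> q"
      using less_not_less_trans[OF zero_closed plus_closed[OF h h] q pos le] .
    have "h \<prec> q"
      using less_not_less_trans[OF h plus_closed[OF h h] q hpos(2) le] .
    then have "h \<prec> q \<oplus> q"
      using less_trans[OF h q plus_closed[OF q q]] less_double[OF q qpos] by blast
    moreover from this have "\<not> q \<oplus> q \<prec> h"
      using less_trans[OF h plus_closed[OF q q] h] less_irrefl[OF h] by blast
    ultimately show ?thesis
      using spread[OF n h q F le] swap[of "suc n" "q \<oplus> q" h] n h q hpos(1) qpos plus_pos[OF q q] by simp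
  qed
  show False
  proof (cases "x \<prec> w")
    case False
    have "\<exists>S. elts S = {q \<in> elts R. \<not> x \<prec> q \<oplus> q \<and>
        (\<exists>n \<in> elts omega. \<exists>p \<in> elts R. rel F n (opair p q) \<and> \<not> q \<prec> p \<and> \<zero> \<prec> p)}"
      by (rule separation_definable) (intro definable_intros definable_fun_plus)
    then obtain S where S: "elts S = {q \<in> elts R. \<not> x \<prec> q \<oplus> q \<and>
        (\<exists>n \<in> elts omega. \<exists>p \<in> elts R. rel F n (opair p q) \<and> \<not> q \<prec> p \<and> \<zero> \<prec> p)}" by blast
    show False
    proof (rule no_bounded_doubling_set[of S w x])
      show "w \<in> elts S"
        using w start missed[OF empty_in_omega w(1) w(1) start w(2) False] less_irrefl[OF w(1)]
          empty_in_omega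
        unfolding S by blast
      fix q assume "q \<in> elts S"
      then obtain n p where np: "n \<in> elts omega" "p \<in> elts R" "rel F n (opair p q)" "\<not> q \<prec> p" "\<zero> \<prec> p"
        and q: "q \<in> elts R" "\<not> x \<prec> q \<oplus> q" using S by blast
      obtain h where h: "h \<in> elts R" "p = h \<oplus> h" using half_exists[OF np(2)] by metis
      note nxt = next_pair[OF np(1) h(1) q(1) np(3-5)[unfolded h(2)]]
      have "\<not> x \<prec> (q \<oplus> q) \<oplus> (q \<oplus> q)"
        using missed[of "suc n" "q \<oplus> q" h] nxt np(1) h(1) q by simp
      then show "q \<oplus> q \<in> elts S"
        using S q(1) nxt h(1) suc_in_omega[OF suc_in_omega[OF np(1)]] by auto
      show "\<not> x \<prec> q"
        using less_double[OF q(1)] nxt q less_trans[OF x(1) q(1) plus_closed[OF q(1) q(1)]] by blast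
    qed (use S w x in auto)
  next
    case True
    have "\<exists>S. elts S = {y \<in> elts R. \<forall>n \<in> elts omega. \<forall>p \<in> elts R. \<forall>q \<in> elts R.
        rel F n (opair p q) \<longrightarrow> \<not> q \<prec> p \<longrightarrow> \<zero> \<prec> p \<longrightarrow> x \<prec> p \<longrightarrow> \<not> p \<prec> y}"
      by (rule separation_definable) (intro definable_intros definable_fun_plus)
    then obtain S where S: "elts S = {y \<in> elts R. \<forall>n \<in> elts omega. \<forall>p \<in> elts R. \<forall>q \<in> elts R.
        rel F n (opair p q) \<longrightarrow> \<not> q \<prec> p \<longrightarrow> \<zero> \<prec> p \<longrightarrow> x \<prec> p \<longrightarrow> \<not> p \<prec> y}" by blast
    show False
    proof (rule no_bounded_doubling_set[of S x w])
      show "x \<in> elts S"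
        using S x less_trans[OF x(1) _ x(1)] less_irrefl[OF x(1)] by blast
      fix y assume y: "y \<in> elts S"
      then have yR: "y \<in> elts R" using S by blast
      have "\<not> p \<prec> y \<oplus> y"
        if p: "n \<in> elts omega" "p \<in> elts R" "q \<in> elts R" "rel F n (opair p q)" "\<not> q \<prec> p" "\<zero> \<prec> p" "x \<prec> p"
        for n p q
      proof -
        obtain h where h: "h \<in> elts R" "p = h \<oplus> h" using half_exists[OF p(2)] by metis
        note nxt = next_pair[OF p(1) h(1) p(3) p(4-6)[unfolded h(2)]]
        have "x \<prec> h"
          using missed[of "suc (suc n)" h "q \<oplus> q"] nxt p h by auto
        then have "\<not> h \<prec> y"
          using y nxt h(1) p(3) suc_in_omega[OF suc_in_omega[OF p(1)]] plus_closed[OF p(3) p(3)]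
          unfolding S by blast
        then show ?thesis using double_less_iff h yR by simp
      qed
      then show "y \<oplus> y \<in> elts S" using S yR by simp
      show "\<not> w \<prec> y"
        using y start w True less_irrefl[OF w(1)] empty_in_omega unfolding S by blast
    qed (use S w x in auto)
  qed
qed

text \<open>
  If \<open>x\<close>, \<open>y\<close> and \<open>x + y\<close> have a common colour and are not zero, then their absolute values fit one
  scale, because the sequence of scales is single-valued; this is impossible.
\<close>

lemma sum_free_colouring:
  "\<exists>c. maps c R omega \<and>
     \<not> (\<exists>x \<in> elts R. \<exists>y \<in> elts R. x \<noteq> y \<and> val c x = val c y \<and> val c y = val c (val2 add x y))"
proof -
  obtain w where w: "w \<in> elts R" "\<zero> \<prec> w" by (rule positive_exists)
  obtain F X where F: "maps F omega X" "sweeps F w"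
    using sweeping_sequence_exists[OF w(1)] by blast
  have unique: "s = t" if "n \<in> elts omega" "rel F n s" "rel F n t" for n s t
    using that val_eqI[OF F(1)] by blast
  define lies_at where "lies_at n x \<longleftrightarrow> (\<exists>p \<in> elts R. \<exists>q \<in> elts R.
      rel F n (opair p q) \<and> \<zero> \<prec> p \<and> in_scale p x)" for n x
  define first_at where "first_at n x \<longleftrightarrow> n \<in> elts omega \<and> lies_at n x \<and>
      (\<forall>m \<in> elts n. m \<in> elts omega \<longrightarrow> \<not> lies_at m x)" for n x
  \<comment> \<open>Indices are shifted by one, since colour 0 is reserved for the element 0.\<close>
  define colour where "colour x k \<longleftrightarrow> x = \<zero> \<and> k = empty_set \<or>
      x \<noteq> \<zero> \<and> (\<exists>n. k = suc n \<and> first_at n x)" for x k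
  have lies_at_exists: "\<exists>n \<in> elts omega. lies_at n x" if x: "x \<in> elts R" "x \<noteq> \<zero>" for x
  proof -
    obtain y where y: "y \<in> elts R" "y = x \<or> y \<oplus> x = \<zero>" "\<zero> \<prec> y"
      using absolute_value_exists[OF x] .
    show ?thesis
      using dyadic_cover[OF w F(2) y(1,3)] y unfolding lies_at_def in_scale_def by blast
  qed
  have "\<exists>!k. k \<in> elts omega \<and> colour x k" if x: "x \<in> elts R" for x
  proof (cases "x = \<zero>")
    case False
    have "definable (\<lambda>s. lies_at (s 0) x)"
      unfolding lies_at_def in_scale_def by (intro definable_intros definable_fun_plus)
    from omega_least[OF lies_at_exists[OF x False] this] obtain n where
      n: "first_at n x" "\<And>k. first_at k x \<Longrightarrow> k = n"
      unfolding first_at_def[symmetric] by blast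
    show ?thesis
    proof (rule ex1I)
      show "suc n \<in> elts omega \<and> colour x (suc n)"
        using n(1) False unfolding colour_def first_at_def by auto
      fix k assume "k \<in> elts omega \<and> colour x k"
      then obtain m where "k = suc m" "first_at m x"
        using False unfolding colour_def by blast
      then show "k = suc n" using n(2) by blast
    qed
  qed (auto simp: colour_def)
  moreover have "definable (\<lambda>s. colour (s 0) (s 1))"
    unfolding colour_def first_at_def lies_at_def in_scale_def by (intro definable_intros definable_fun_plus)
  ultimately obtain c where c: "maps c R omega" "\<And>x. x \<in> elts R \<Longrightarrow> colour x (val c x)"
    using function_exists[of R omega colour] by blast
  have False if xy: "x \<in> elts R" "y \<in> elts R" "x \<noteq> y" "val c x = val c y" "val c y = val c (x \<oplus> y)" for x y
  proof -
    have z: "x \<oplus> y \<in> elts R" using xy by simp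
    note cs = c(2)[OF xy(1)] c(2)[OF xy(2)] c(2)[OF z]
    show False
    proof (cases "val c x = empty_set")
      case True
      then have "x = \<zero>" "y = \<zero>" using cs xy(4) unfolding colour_def by auto
      then show False using xy(3) by simp
    next
      case False
      then obtain n where n: "n \<in> elts omega" "lies_at n x" "lies_at n y" "lies_at n (x \<oplus> y)"
        using cs xy(4,5) unfolding colour_def first_at_def by auto
      then obtain p q where "p \<in> elts R" "rel F n (opair p q)" "\<zero> \<prec> p" "in_scale p x"
        unfolding lies_at_def by blast
      moreover from this have "in_scale p y" "in_scale p (x \<oplus> y)"
        using n(3,4) unique[OF n(1)] unfolding lies_at_def by (metis opair_inject)+
      ultimately show False using in_scale_sum_free xy(1,2) by blast
    qed
  qed
  then show ?thesis using c(1) plus_eq_val2 by metis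
qed

end


section \<open>Finite sums of sequences of length two\<close>

context zf_model
begin

lemma elts_two: "elts two = {suc empty_set, empty_set}"
  by (simp add: two_def)

lemma unary_function_exists:
  assumes "a \<in> elts B"
  shows "\<exists>f. maps f (suc empty_set) B \<and> val f empty_set = a"
proof -
  have "definable (\<lambda>s. s 1 = a)" by (intro definable_intros)
  from function_exists[OF _ this, of "suc empty_set" B] show ?thesis
    using assms by auto
qed

lemma binary_function_exists:
  assumes "a \<in> elts B" "b \<in> elts B"
  shows "\<exists>f. maps f two B \<and> val f empty_set = a \<and> val f (suc empty_set) = b"
proof -
  have "definable (\<lambda>s. s 0 = empty_set \<and> s 1 = a \<or> s 0 \<noteq> empty_set \<and> s 1 = b)"
    by (intro definable_intros)
  from function_exists[OF _ this, of two B] show ?thesis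
    using assms by (fastforce simp: elts_two)
qed

lemma in_FS_single:
  assumes "maps x \<kappa> G" "i \<in> elts \<kappa>"
  shows "in_FS G add \<kappa> x (val x i)"
proof -
  obtain e where e: "maps e (suc empty_set) \<kappa>" "val e empty_set = i"
    using unary_function_exists[OF assms(2)] by blast
  obtain t where t: "maps t (suc empty_set) G" "val t empty_set = val x i"
    using unary_function_exists[OF maps_val(2)[OF assms]] by blast
  show ?thesis
    unfolding in_FS_def injects_def
    by (rule bexI[of _ empty_set], rule exI[of _ e], rule exI[of _ t]) (simp_all add: e t)
qed

lemma in_FS_pair:
  assumes "maps x \<kappa> G" "i \<in> elts \<kappa>" "j \<in> elts \<kappa>" "i \<noteq> j" "val2 add (val x i) (val x j) \<in> elts G"
  shows "in_FS G add \<kappa> x (val2 add (val x i) (val x j))"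
proof -
  obtain e where e: "maps e two \<kappa>" "val e empty_set = i" "val e (suc empty_set) = j"
    using binary_function_exists[OF assms(2,3)] by blast
  obtain t where t: "maps t two G" "val t empty_set = val x i"
    "val t (suc empty_set) = val2 add (val x i) (val x j)"
    using binary_function_exists[OF maps_val(2)[OF assms(1,2)] assms(5)] by blast
  show ?thesis
    unfolding in_FS_def injects_def
    by (rule bexI[of _ "suc empty_set"], rule exI[of _ e], rule exI[of _ t])
      (use e t assms(4) in \<open>simp_all add: two_def inj_on_def\<close>)
qed

lemma arrow_two_monochromatic_sum:
  assumes arrow: "arrow G add two \<theta>" and add: "\<And>x y. x \<in> elts G \<Longrightarrow> y \<in> elts G \<Longrightarrow> val2 add x y \<in> elts G"
    and c: "maps c G \<theta>"
  shows "\<exists>x \<in> elts G. \<exists>y \<in> elts G. x \<noteq> y \<and> val c x = val c y \<and> val c y = val c (val2 add x y)"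
proof -
  obtain x i where x: "maps x two G" "inj_on (val x) (elts two)"
    and mono: "\<And>s. in_FS G add two x s \<Longrightarrow> val c s = i"
    using arrow c unfolding arrow_def injects_def by blast
  define a b where "a = val x empty_set" and "b = val x (suc empty_set)"
  have two: "empty_set \<in> elts two" "suc empty_set \<in> elts two" "empty_set \<noteq> suc empty_set"
    by (simp_all add: elts_two)
  have ab: "a \<in> elts G" "b \<in> elts G" "a \<noteq> b"
    unfolding a_def b_def using maps_val(2)[OF x(1)] two inj_onD[OF x(2) _ two(1,2)] by blast+
  moreover have "val c a = i" "val c b = i"
    using mono in_FS_single[OF x(1)] two unfolding a_def b_def by blast+
  moreover have "val c (val2 add a b) = i"
    using mono in_FS_pair[OF x(1) two] add ab(1,2) unfolding a_def b_def by blast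
  ultimately show ?thesis by metis
qed

end


section \<open>The type of real numbers\<close>

lemma real_sum_free_colouring:
  "\<exists>c :: real \<Rightarrow> nat. \<not> (\<exists>x y. x \<noteq> y \<and> c x = c y \<and> c y = c (x + y))"
proof -
  define c :: "real \<Rightarrow> nat" where
    "c x = (if x = 0 then 0 else Suc (int_encode \<lfloor>log 2 \<bar>x\<bar>\<rfloor>))" for x
  have scale: "2 powr real_of_int k \<le> \<bar>x\<bar> \<and> \<bar>x\<bar> < 2 * 2 powr real_of_int k"
    if "c x = Suc (int_encode k)" for x k
  proof -
    have "x \<noteq> 0" "\<lfloor>log 2 \<bar>x\<bar>\<rfloor> = k"
      using that unfolding c_def by (auto simp: int_encode_eq split: if_splits)
    then show ?thesis
      using floor_log_eq_powr_iff[of "\<bar>x\<bar>" 2 k] by (simp add: powr_add)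
  qed
  have False if "x \<noteq> y" "c x = c y" "c y = c (x + y)" for x y
  proof (cases "c x = 0")
    case True
    then have "x = 0" "y = 0" using that unfolding c_def by (auto split: if_splits)
    then show False using that(1) by simp
  next
    case False
    then obtain k where "c x = Suc (int_encode k)"
      unfolding c_def by (auto split: if_splits)
    with that(2,3) have k: "c x = Suc (int_encode k)" "c y = Suc (int_encode k)"
      "c (x + y) = Suc (int_encode k)" by simp_all
    define a where "a = 2 powr real_of_int k"
    have "a \<le> \<bar>x\<bar>" "\<bar>x\<bar> < 2 * a" "a \<le> \<bar>y\<bar>" "\<bar>y\<bar> < 2 * a" "a \<le> \<bar>x + y\<bar>" "\<bar>x + y\<bar> < 2 * a"
      using k[THEN scale] unfolding a_def by blast+
    then show False by arith
  qed
  then show ?thesis by blast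
qed

lemma fs_arrow_two_monochromatic_sum:
  assumes "fs_arrow G {..<2::nat} K" "c ` G \<subseteq> K"
  shows "\<exists>x \<in> G. \<exists>y \<in> G. x \<noteq> y \<and> c x = c y \<and> c y = c (x + y)"
proof -
  obtain x k where x: "x ` {..<2} \<subseteq> G" "inj_on x {..<2::nat}" and
    mono: "\<And>s. s \<in> FS x {..<2} \<Longrightarrow> c s = k"
    using assms(1)[unfolded fs_arrow_def, rule_format, OF assms(2)] by blast
  have sums: "c (sum x A) = k" if "finite A" "A \<noteq> {}" "A \<subseteq> {..<2}" for A
    using mono that unfolding FS_def by blast
  have "c (x 0) = k" "c (x 1) = k" "c (x 0 + x 1) = k"
    using sums[of "{0}"] sums[of "{1}"] sums[of "{0, 1}"] by auto
  moreover have "x 0 \<noteq> x 1" using inj_onD[OF x(2), of 0 1] by auto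
  ultimately have "x 0 \<noteq> x 1 \<and> c (x 0) = c (x 1) \<and> c (x 1) = c (x 0 + x 1)"
    by simp
  moreover have "x 0 \<in> G" "x 1 \<in> G" using x(1) by auto
  ultimately show ?thesis by blast
qed

theorem theorem2p9:
  "(\<forall>(mem :: 'v \<Rightarrow> 'v \<Rightarrow> bool) R add mult lt.
      zf_model mem \<and> membership.complete_ordered_field mem R add mult lt \<longrightarrow>
        \<not> membership.arrow mem R add (membership.two mem) (membership.omega mem) \<and>
        (\<exists>c. membership.maps mem c R (membership.omega mem) \<and>
           \<not> (\<exists>x \<in> membership.elts mem R. \<exists>y \<in> membership.elts mem R. x \<noteq> y \<and>
                membership.val mem c x = membership.val mem c y \<and>
                membership.val mem c y = membership.val mem c (membership.val2 mem add x y)))) \<and>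
   \<not> fs_arrow (UNIV :: real set) {..<2::nat} (UNIV :: nat set) \<and>
   (\<exists>c :: real \<Rightarrow> nat. \<not> (\<exists>x y. x \<noteq> y \<and> c x = c y \<and> c y = c (x + y)))"
proof (intro conjI allI impI)
  fix mem :: "'v \<Rightarrow> 'v \<Rightarrow> bool" and R add mult lt
  assume "zf_model mem \<and> membership.complete_ordered_field mem R add mult lt"
  then interpret zf_reals mem R add mult lt
    by (simp add: zf_reals_def zf_reals_axioms_def)
  show "\<exists>c. maps c R omega \<and> \<not> (\<exists>x \<in> elts R. \<exists>y \<in> elts R. x \<noteq> y \<and>
      val c x = val c y \<and> val c y = val c (val2 add x y))"
    by (rule sum_free_colouring)
  then show "\<not> arrow R add two omega"
    using arrow_two_monochromatic_sum[OF _ val2_closed[OF binop_add]] by blast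
next
  show "\<not> fs_arrow (UNIV :: real set) {..<2::nat} (UNIV :: nat set)"
    using real_sum_free_colouring fs_arrow_two_monochromatic_sum[of UNIV UNIV] by blast
next
  show "\<exists>c :: real \<Rightarrow> nat. \<not> (\<exists>x y. x \<noteq> y \<and> c x = c y \<and> c y = c (x + y))"
    by (rule real_sum_free_colouring)
qed

end
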